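(* Let $\varphi$ be a $C^2$ finite-time nonautonomous dynamical system on $X$ over $J$ and let $\alpha\in\mathbb{R}$. Then for every $(t_0,x_0)\in X$ $$h^{\varphi,\alpha}_{t_0}(x_0)=-\frac1{|J|}\log\left(\frac{\Gamma(\frac n2+1)}{\pi^{n/2}}\,\mu\Big(\bigcap_{t\in J}E\big(\Phi_{x_0}(t,t_0)e^{-\alpha(t-t_0)}\big)\Big)\right),$$ where $\Gamma$ is the Gamma function.
   Context: Let $J\subset\mathbb{R}$ be compact, $|J|:=\max J-\min J$, let $(X(t))_{t\in J}$ be a family of subsets of $\mathbb{R}^n$ and $X:=\{(t,x)\in J\times\mathbb{R}^n: x\in X(t)\}$. A finite-time nonautonomous dynamical system (FTNDS) $\varphi$ on $X$ over $J$ is a family of maps $\varphi(t,s):X(s)\to X(t)$, $t,s\in J$, with $(t,s,x)\mapsto\varphi(t,s)x$ continuous, $\varphi(s,s)x=x$ and $\varphi(t,u)\varphi(u,s)x=\varphi(t,s)x$ for all $t,u,s\in J$, $x\in X(s)$. It is called $C^k$ if for all $t,s\in J$ the maps $\varphi(t,s):X(s)\to X(t)$ are $C^k$ and all derivatives depend continuously on $t,s\in J$. $\|\cdot\|$ is the Euclidean norm, $\mu$ is $n$-dimensional Lebesgue measure, $B(x_0,\varepsilon):=\{x\in\mathbb{R}^n:\|x-x_0\|\le\varepsilon\}$. For $\alpha\in\mathbb{R}$, $(t_0,x_0)\in X$, $\varepsilon\ge0$ let $$B^{\varphi,\alpha}_{t_0}(x_0,\varepsilon):=\Big\{x\in X(t_0):\sup_{t\in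 J}\|\varphi(t,t_0)x-\varphi(t,t_0)x_0\|e^{-\alpha(t-t_0)}\le\varepsilon\Big\}.$$ The finite-time metric entropy (FTME) with weight $\alpha$ at $(t_0,x_0)$ is $$h^{\varphi,\alpha}_{t_0}(x_0):=\limsup_{\varepsilon\to0}-\frac1{|J|}\log\frac{\mu(B^{\varphi,\alpha}_{t_0}(x_0,\varepsilon))}{\mu(B(x_0,\varepsilon))}.$$ For $(t_0,x_0)\in X$, $\Phi_{x_0}(t,t_0):=D\varphi(t,t_0)x_0\in\mathbb{R}^{n\times n}$ denotes the derivative of $x\mapsto\varphi(t,t_0)x$ at $x_0$. For an invertible matrix $A\in\mathbb{R}^{n\times n}$, $E(A):=A^{-1}B(0,1)=\{x\in\mathbb{R}^n:\langle x,A^\top Ax\rangle\le1\}$.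
   Formalization: The sets X(t) are assumed open (otherwise the formula fails, e.g. X(t)=[0,∞), φ=id, x_0=0), and "all derivatives depend continuously on t,s" is read as joint continuity in (t,s,x). *)

theory Defs
  imports "HOL-Analysis.Analysis"
begin

(* A family of maps phi(t,s) : X(s) -> X(t) is a total function
   phi :: real => real => 'a => 'a whose values phi t s x matter only for
   t, s in J and x in X s. *)

definition ftnds ::
  "real set \<Rightarrow> (real \<Rightarrow> 'a::topological_space set) \<Rightarrow> (real \<Rightarrow> real \<Rightarrow> 'a \<Rightarrow> 'a) \<Rightarrow> bool" where
  "ftnds J X \<phi> \<longleftrightarrow>
     compact J \<and>
     (\<forall>t\<in>J. \<forall>s\<in>J. \<phi> t s ` X s \<subseteq> X t) \<and>
     continuous_on {(t, s, x). t \<in> J \<and> s \<in> J \<and> x \<in> X s} (\<lambda>(t, s, x). \<phi> t s x) \<and>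
     (\<forall>s\<in>J. \<forall>x\<in>X s. \<phi> s s x = x) \<and>
     (\<forall>t\<in>J. \<forall>u\<in>J. \<forall>s\<in>J. \<forall>x\<in>X s. \<phi> t u (\<phi> u s x) = \<phi> t s x)"

(* The maps f t s are k times continuously differentiable on X s and all their
   derivatives up to order k depend continuously on (t, s, x). Higher derivatives are
   represented by iterated derivatives along fixed vectors, which in finite dimension is
   equivalent to using the multilinear derivatives. The derivative at x is only
   meaningful for open X s, since then it does not see values of f t s outside X s. *)
primrec Ck_family ::
  "nat \<Rightarrow> real set \<Rightarrow> (real \<Rightarrow> 'a set) \<Rightarrow>
   (real \<Rightarrow> real \<Rightarrow> 'a::euclidean_space \<Rightarrow> 'b::euclidean_space) \<Rightarrow> bool" where
  "Ck_family 0 J X f \<longleftrightarrow>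
     continuous_on {(t, s, x). t \<in> J \<and> s \<in> J \<and> x \<in> X s} (\<lambda>(t, s, x). f t s x)"
| "Ck_family (Suc k) J X f \<longleftrightarrow>
     continuous_on {(t, s, x). t \<in> J \<and> s \<in> J \<and> x \<in> X s} (\<lambda>(t, s, x). f t s x) \<and>
     (\<forall>t\<in>J. \<forall>s\<in>J. \<forall>x\<in>X s. f t s differentiable (at x)) \<and>
     (\<forall>v. Ck_family k J X (\<lambda>t s x. frechet_derivative (f t s) (at x) v))"

(* Openness of the X t is part of the C^k property: it is what makes the derivatives of
   the maps X s -> X t well defined. *)
definition Ck_ftnds ::
  "nat \<Rightarrow> real set \<Rightarrow> (real \<Rightarrow> 'a::euclidean_space set) \<Rightarrow> (real \<Rightarrow> real \<Rightarrow> 'a \<Rightarrow> 'a) \<Rightarrow> bool"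
  where
  "Ck_ftnds k J X \<phi> \<longleftrightarrow> ftnds J X \<phi> \<and> (\<forall>t\<in>J. open (X t)) \<and> Ck_family k J X \<phi>"

(* max J - min J for nonempty compact J *)
definition time_length :: "real set \<Rightarrow> real" where
  "time_length J = Sup J - Inf J"

(* The real-valued ln has ln 0 = 0; here the logarithm of 0 is minus infinity. *)
definition elog :: "real \<Rightarrow> ereal" where
  "elog x = (if x > 0 then ereal (ln x) else - \<infinity>)"

definition ft_ball ::
  "real set \<Rightarrow> (real \<Rightarrow> 'a set) \<Rightarrow> (real \<Rightarrow> real \<Rightarrow> 'a \<Rightarrow> 'a) \<Rightarrow>
   real \<Rightarrow> real \<Rightarrow> 'a::real_normed_vector \<Rightarrow> real \<Rightarrow> 'a set" where
  "ft_ball J X \<phi> \<alpha> t\<^sub>0 x\<^sub>0 \<epsilon> =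
     {x \<in> X t\<^sub>0. (SUP t\<in>J. ereal (norm (\<phi> t t\<^sub>0 x - \<phi> t t\<^sub>0 x\<^sub>0) * exp (- \<alpha> * (t - t\<^sub>0)))) \<le> ereal \<epsilon>}"

definition ftme ::
  "real set \<Rightarrow> (real \<Rightarrow> 'a set) \<Rightarrow> (real \<Rightarrow> real \<Rightarrow> 'a \<Rightarrow> 'a) \<Rightarrow>
   real \<Rightarrow> real \<Rightarrow> 'a::euclidean_space \<Rightarrow> ereal" where
  "ftme J X \<phi> \<alpha> t\<^sub>0 x\<^sub>0 =
     Limsup (at_right 0) (\<lambda>\<epsilon>. - (ereal (1 / time_length J) *
       elog (measure lebesgue (ft_ball J X \<phi> \<alpha> t\<^sub>0 x\<^sub>0 \<epsilon>) / measure lebesgue (cball x\<^sub>0 \<epsilon>))))"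

definition ellipsoid :: "real ^ 'n ^ 'n \<Rightarrow> (real ^ 'n) set" where
  "ellipsoid A = {x. x \<bullet> ((transpose A ** A) *v x) \<le> 1}"

lemma ellipsoid_eq_vimage: "ellipsoid A = (*v) A -` cball 0 1"
proof -
  have "x \<bullet> ((transpose A ** A) *v x) = (norm (A *v x))\<^sup>2" for x
    by (simp add: dot_lmul_matrix[symmetric] matrix_vector_mul_assoc[symmetric]
        power2_norm_eq_inner inner_commute)
  then show ?thesis
    by (auto simp: ellipsoid_def abs_square_le_1)
qed

lemma ellipsoid_invertible:
  assumes "invertible A"
  shows "ellipsoid A = (*v) (matrix_inv A) ` cball 0 1"
proof -
  have *: "A ** matrix_inv A = mat 1 \<and> matrix_inv A ** A = mat 1"
    using assms unfolding invertible_def matrix_inv_def by (rule someI_ex)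
  have right: "A *v (matrix_inv A *v x) = x" and left: "matrix_inv A *v (A *v x) = x" for x
    using * by (simp_all add: matrix_vector_mul_assoc)
  have "x \<in> (*v) (matrix_inv A) ` cball 0 1" if "A *v x \<in> cball 0 1" for x
    using that left[of x] by (metis imageI)
  then show ?thesis
    unfolding ellipsoid_eq_vimage by (auto simp: right)
qed

end

theory Submission
  imports Defs
begin

text \<open>
  Write \<open>C(t)\<close> for the weighted derivative at \<open>x\<^sub>0\<close> and \<open>K\<close> for the intersection of the unit
  ellipsoids of the \<open>C(t)\<close>. Since the derivative is continuous and \<open>J\<close> is compact, the linearisation
  error at \<open>x\<^sub>0\<close> is at most \<open>\<eta> \<parallel>x - x\<^sub>0\<parallel>\<close> for \<open>x\<close> near \<open>x\<^sub>0\<close>, uniformly in \<open>t \<in> J\<close>. The time \<open>t\<^sub>0\<close>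
  forces both the finite-time ball to lie in the Euclidean \<open>\<epsilon>\<close>-ball and \<open>K\<close> to lie in the unit ball,
  so for small \<open>\<epsilon>\<close> the finite-time ball is squeezed between \<open>x\<^sub>0 + \<epsilon>(1-\<eta>)K\<close> and \<open>x\<^sub>0 + \<epsilon>(1+\<eta>)K\<close>.
  Hence its volume relative to the Euclidean ball converges to the volume of \<open>K\<close> relative to the unit
  ball, which is positive because the \<open>C(t)\<close> are uniformly bounded.
\<close>

section \<open>Linearisation at a point, uniform in time\<close>

text \<open>Heine-Cantor on the compact product of \<open>J\<close> with a small closed ball: the
  resulting modulus of continuity does not depend on \<open>t\<close>.\<close>

lemma uniformly_close_on_compact_fibre:
  fixes g :: "'t::metric_space \<times> 'a::heine_borel \<Rightarrow> 'b::metric_space"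
  assumes "compact J" "open S" "x0 \<in> S" "continuous_on (J \<times> S) g" "e > 0"
  shows "\<forall>\<^sub>F x in nhds x0. \<forall>t\<in>J. dist (g (t, x)) (g (t, x0)) < e"
proof -
  obtain r where r: "r > 0" "cball x0 r \<subseteq> S"
    using assms(2,3) open_contains_cball by blast
  have "uniformly_continuous_on (J \<times> cball x0 r) g"
    using r(2) by (intro compact_uniformly_continuous continuous_on_subset[OF assms(4)]
        compact_Times assms(1)) auto
  then obtain d where d: "d > 0"
    "\<And>p q. p \<in> J \<times> cball x0 r \<Longrightarrow> q \<in> J \<times> cball x0 r \<Longrightarrow> dist q p < d \<Longrightarrow> dist (g q) (g p) < e"
    unfolding uniformly_continuous_on_def using assms(5) by metis
  have "\<forall>\<^sub>F x in nhds x0. x \<in> ball x0 (min d r)"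
    using d(1) r(1) by (intro eventually_nhds_in_open) auto
  then show ?thesis
  proof eventually_elim
    case (elim x)
    show ?case
    proof
      fix t assume t: "t \<in> J"
      have "dist (t, x) (t, x0) = dist x x0" by (simp add: dist_Pair_Pair)
      then show "dist (g (t, x)) (g (t, x0)) < e"
        using elim t r by (intro d(2)) (auto simp: dist_commute)
    qed
  qed
qed

text \<open>Each coordinate of \<open>v\<close> is at most \<open>norm v\<close>. This turns bounds
  along fixed vectors, the form in which continuity of the derivatives is given, into operator norm
  bounds.\<close>

lemma linear_norm_le_Basis:
  fixes L :: "'a::euclidean_space \<Rightarrow> 'b::real_normed_vector"
  assumes "linear L" "\<And>b. b \<in> Basis \<Longrightarrow> norm (L b) \<le> c"
  shows "norm (L v) \<le> real DIM('a) * c * norm v"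
proof -
  interpret linear L by fact
  have "norm (L v) = norm (\<Sum>b\<in>Basis. (v \<bullet> b) *\<^sub>R L b)"
    by (subst euclidean_representation[of v, symmetric]) (simp only: sum scale)
  also have "\<dots> \<le> (\<Sum>b\<in>(Basis::'a set). norm v * c)"
    by (intro sum_norm_le) (auto intro!: mult_mono assms(2) Basis_le_norm)
  finally show ?thesis by (simp add: algebra_simps)
qed

text \<open>Mean value inequality for \<open>f t\<close> minus its linear part at \<open>x0\<close>:
  near \<open>x0\<close> the derivative of this difference is small, uniformly in
  \<open>t\<close>.\<close>

lemma uniform_linear_approximation:
  fixes f :: "'t::metric_space \<Rightarrow> 'a::euclidean_space \<Rightarrow> 'b::real_normed_vector"
  assumes "compact J" "open S" "x0 \<in> S"
    and der: "\<And>t x. t \<in> J \<Longrightarrow> x \<in> S \<Longrightarrow> (f t has_derivative D t x) (at x)"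
    and cont: "\<And>v. continuous_on (J \<times> S) (\<lambda>(t, x). D t x v)"
    and e: "e > 0"
  obtains d where "d > 0" "cball x0 d \<subseteq> S"
    "\<And>t x. t \<in> J \<Longrightarrow> x \<in> cball x0 d \<Longrightarrow>
      norm (f t x - f t x0 - D t x0 (x - x0)) \<le> e * norm (x - x0)"
proof -
  \<comment> \<open>The division cancels the dimension factor of
    \<open>linear_norm_le_Basis\<close>.\<close>
  define c where "c = e / real DIM('a)"
  have c: "c > 0" unfolding c_def using e by simp
  have "\<forall>\<^sub>F x in nhds x0. \<forall>b\<in>Basis. \<forall>t\<in>J. norm (D t x b - D t x0 b) < c"
    using uniformly_close_on_compact_fibre[OF assms(1-3) cont c]
    by (intro eventually_ball_finite) (auto simp: dist_norm)
  then have "\<forall>\<^sub>F x in nhds x0. x \<in> S \<and> (\<forall>b\<in>Basis. \<forall>t\<in>J. norm (D t x b - D t x0 b) < c)"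
    using eventually_nhds_in_open[OF assms(2,3)] by (simp add: eventually_conj)
  then obtain d0 where d0: "d0 > 0"
    "\<And>x. dist x x0 < d0 \<Longrightarrow> x \<in> S \<and> (\<forall>b\<in>Basis. \<forall>t\<in>J. norm (D t x b - D t x0 b) < c)"
    unfolding eventually_nhds_metric by blast
  \<comment> \<open>Halving puts the closed ball, which is convex, inside the open ball of radius
    \<open>d0\<close>.\<close>
  define d where "d = d0 / 2"
  have d: "d > 0" "\<And>x. x \<in> cball x0 d \<Longrightarrow> dist x x0 < d0"
    using d0(1) by (auto simp: d_def dist_commute)
  show thesis
  proof (rule that[OF d(1)])
    show "cball x0 d \<subseteq> S" using d d0 by blast
    fix t x assume t: "t \<in> J" and x: "x \<in> cball x0 d"
    have 1: "((\<lambda>y. f t y - D t x0 y) has_derivative (\<lambda>v. D t y v - D t x0 v)) (at y within cball x0 d)"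
      if "y \<in> cball x0 d" for y
    proof -
      have "(f t has_derivative D t y) (at y within cball x0 d)"
        using der[OF t] that d d0 has_derivative_at_withinI by blast
      moreover have "bounded_linear (D t x0)"
        using der[OF t assms(3)] has_derivative_bounded_linear by blast
      ultimately show ?thesis
        by (intro has_derivative_diff bounded_linear_imp_has_derivative)
    qed
    have 2: "onorm (\<lambda>v. D t y v - D t x0 v) \<le> e" if "y \<in> cball x0 d" for y
    proof (rule onorm_le)
      fix v
      have "linear (\<lambda>v. D t y v - D t x0 v)"
        using has_derivative_linear[OF 1[OF that]] .
      moreover have "norm (D t y b - D t x0 b) \<le> c" if "b \<in> Basis" for b
        using d0(2)[OF d(2)[OF \<open>y \<in> cball x0 d\<close>]] t that by (auto intro: less_imp_le)
      ultimately have "norm (D t y v - D t x0 v) \<le> real DIM('a) * c * norm v"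
        by (rule linear_norm_le_Basis)
      then show "norm (D t y v - D t x0 v) \<le> e * norm v" by (simp add: c_def)
    qed
    have "norm ((f t x - D t x0 x) - (f t x0 - D t x0 x0)) \<le> e * norm (x - x0)"
      using d(1) x by (intro differentiable_bound[OF convex_cball 1 2]) auto
    moreover have "D t x0 (x - x0) = D t x0 x - D t x0 x0"
      using linear_diff[OF has_derivative_linear[OF der[OF t assms(3)]]] .
    then have "f t x - f t x0 - D t x0 (x - x0) = (f t x - D t x0 x) - (f t x0 - D t x0 x0)"
      by simp
    ultimately show "norm (f t x - f t x0 - D t x0 (x - x0)) \<le> e * norm (x - x0)"
      by (simp only:)
  qed
qed

section \<open>Volume asymptotics of finite-time balls\<close>

text \<open>Both factors tend to 1 as \<eta> tends to 0, so for any \<open>a\<close> on one side of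
  \<open>L\<close> a fixed small \<eta> already separates \<open>r x\<close> from \<open>a\<close>
  eventually.\<close>

lemma tendsto_of_power_bounds:
  fixes r :: "'a \<Rightarrow> real"
  assumes "\<And>\<eta>. 0 < \<eta> \<Longrightarrow> \<eta> < 1 \<Longrightarrow> \<forall>\<^sub>F x in F. (1 - \<eta>) ^ n * L \<le> r x \<and> r x \<le> (1 + \<eta>) ^ n * L"
  shows "(r \<longlongrightarrow> L) F"
proof (rule order_tendstoI)
  have small: "\<forall>\<^sub>F \<eta> in at_right (0::real). 0 < \<eta> \<and> \<eta> < 1"
    using eventually_at_right_real[of 0 1] by simp
  have low: "((\<lambda>\<eta>::real. (1 - \<eta>) ^ n * L) \<longlongrightarrow> (1 - 0) ^ n * L) (at_right 0)"
    and up: "((\<lambda>\<eta>::real. (1 + \<eta>) ^ n * L) \<longlongrightarrow> (1 + 0) ^ n * L) (at_right 0)"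
    by (intro tendsto_intros)+
  show "\<forall>\<^sub>F x in F. a < r x" if "a < L" for a
  proof -
    have "\<forall>\<^sub>F \<eta> in at_right (0::real). a < (1 - \<eta>) ^ n * L"
      using order_tendstoD(1)[OF low] that by simp
    with small obtain \<eta> :: real where "0 < \<eta>" "\<eta> < 1" "a < (1 - \<eta>) ^ n * L"
      using eventually_happens'[OF trivial_limit_at_right_real eventually_conj] by blast
    then show ?thesis using assms[of \<eta>] by (auto elim: eventually_mono)
  qed
  show "\<forall>\<^sub>F x in F. r x < a" if "L < a" for a
  proof -
    have "\<forall>\<^sub>F \<eta> in at_right (0::real). (1 + \<eta>) ^ n * L < a"
      using order_tendstoD(2)[OF up] that by simp
    with small obtain \<eta> :: real where "0 < \<eta>" "\<eta> < 1" "(1 + \<eta>) ^ n * L < a"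
      using eventually_happens'[OF trivial_limit_at_right_real eventually_conj] by blast
    then show ?thesis using assms[of \<eta>] by (auto elim: eventually_mono)
  qed
qed

text \<open>The isometry at \<open>t0\<close> bounds the set. Compactness of \<open>J\<close> bounds
  all \<open>D t\<close> on the finite basis at once, so the set contains a ball.\<close>

lemma
  fixes D :: "'t::metric_space \<Rightarrow> 'a::euclidean_space \<Rightarrow> 'b::real_normed_vector"
  assumes "compact J"
    and lin: "\<And>t. t \<in> J \<Longrightarrow> linear (D t)"
    and cont: "\<And>v. continuous_on J (\<lambda>t. D t v)"
    and t0: "t0 \<in> J" "\<And>v. norm (D t0 v) = norm v"
  shows compact_unit_Inter: "compact {v. \<forall>t\<in>J. norm (D t v) \<le> 1}" (is "compact ?K")
    and measure_unit_Inter_pos: "measure lebesgue {v. \<forall>t\<in>J. norm (D t v) \<le> 1} > 0"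
proof -
  have "?K = (\<Inter>t\<in>J. {v. norm (D t v) \<le> 1})" by auto
  moreover have "closed {v. norm (D t v) \<le> 1}" if "t \<in> J" for t
    using lin[OF that] by (intro closed_Collect_le continuous_intros linear_continuous_on)
      (simp add: linear_linear)
  ultimately have "closed ?K" by auto
  moreover have "bounded ?K"
    using t0 by (intro boundedI[of _ 1]) auto
  ultimately show K: "compact ?K" by (simp add: compact_eq_bounded_closed)
  have "bounded (\<Union>b\<in>Basis. (\<lambda>t. D t b) ` J)"
    by (intro bounded_UN ballI compact_imp_bounded compact_continuous_image cont assms(1))
      (rule finite_Basis)
  then obtain M where M: "M > 0" "\<And>b t. b \<in> Basis \<Longrightarrow> t \<in> J \<Longrightarrow> norm (D t b) \<le> M"
    unfolding bounded_pos by auto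
  \<comment> \<open>The reciprocal of the uniform operator bound from
    \<open>linear_norm_le_Basis\<close>.\<close>
  define r where "r = 1 / (real DIM('a) * M)"
  have r: "r > 0" using M(1) by (simp add: r_def)
  have "cball 0 r \<subseteq> ?K"
  proof clarify
    fix v :: 'a and t assume v: "v \<in> cball 0 r" and t: "t \<in> J"
    have "norm (D t v) \<le> real DIM('a) * M * norm v"
      using M(2) t by (intro linear_norm_le_Basis lin) auto
    also have "\<dots> \<le> real DIM('a) * M * r"
      using v M(1) by (intro mult_left_mono) auto
    also have "\<dots> = 1" using M(1) by (simp add: r_def)
    finally show "norm (D t v) \<le> 1" .
  qed
  then have "measure lebesgue (cball (0::'a) r) \<le> measure lebesgue ?K"
    by (rule measure_mono_fmeasurable) (simp_all add: lmeasurable_compact[OF K])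
  moreover have "measure lebesgue (cball (0::'a) r) > 0"
    using r by (simp add: content_cball_pos)
  ultimately show "measure lebesgue ?K > 0" by linarith
qed

text \<open>Only a family that is the identity at one time appears here, so exponential weights can
  be absorbed into \<open>f\<close>. The scaled copies of \<open>K\<close> and the Euclidean ball
  share the factor \<open>\<epsilon> ^ n\<close>, which cancels in the quotient.\<close>

lemma measure_dynamical_ball_tendsto:
  fixes f :: "'t::metric_space \<Rightarrow> 'a::euclidean_space \<Rightarrow> 'a"
  assumes J: "compact J" and S: "open S" "x0 \<in> S"
    and der: "\<And>t x. t \<in> J \<Longrightarrow> x \<in> S \<Longrightarrow> (f t has_derivative D t x) (at x)"
    and cont: "\<And>v. continuous_on (J \<times> S) (\<lambda>(t, x). D t x v)"
    and t0: "t0 \<in> J" "\<And>x. x \<in> S \<Longrightarrow> f t0 x = x"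
  defines "B \<equiv> \<lambda>\<epsilon>. {x \<in> S. \<forall>t\<in>J. norm (f t x - f t x0) \<le> \<epsilon>}"
    and "K \<equiv> {v. \<forall>t\<in>J. norm (D t x0 v) \<le> 1}"
  shows "((\<lambda>\<epsilon>. measure lebesgue (B \<epsilon>) / measure lebesgue (cball x0 \<epsilon>)) \<longlongrightarrow>
            measure lebesgue K / unit_ball_vol (real DIM('a))) (at_right 0)"
    and "measure lebesgue K > 0"
proof -
  \<comment> \<open>\<open>f t0\<close> agrees with the identity on the open set \<open>S\<close>,
    hence both have the same derivative at \<open>x0\<close>.\<close>
  have "((\<lambda>x. x) has_derivative D t0 x0) (at x0)"
    using has_derivative_transform_within_open[OF der[OF t0(1) S(2)] S t0(2)] .
  then have D0: "D t0 x0 = (\<lambda>v. v)"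
    using has_derivative_ident has_derivative_unique by blast
  have lin: "linear (D t x0)" if "t \<in> J" for t
    using der[OF that S(2)] has_derivative_linear by blast
  have contJ: "continuous_on J (\<lambda>t. D t x0 v)" for v
  proof -
    have "continuous_on J (\<lambda>t. (t, x0))" by (intro continuous_intros)
    from continuous_on_compose2[OF cont this, of v] show ?thesis using S(2) by auto
  qed
  note unit = J lin contJ t0(1)
  have K: "compact K" and Kpos: "measure lebesgue K > 0"
    unfolding K_def
    by (rule compact_unit_Inter[OF unit] measure_unit_Inter_pos[OF unit]; simp add: D0)+
  show "measure lebesgue K > 0" by fact
  have K1: "norm v \<le> 1" if "v \<in> K" for v
    using that t0(1) D0 by (auto simp: K_def)
  have affK: "(\<lambda>v. m *\<^sub>R v + x0) ` K \<in> lmeasurable" for m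
    by (intro lmeasurable_compact compact_continuous_image K continuous_intros)
  \<comment> \<open>\<open>B \<epsilon>\<close> is relatively closed in \<open>S\<close>, hence the
    intersection of an open and a closed set. This also covers uncountable \<open>J\<close>.\<close>
  have Bsets: "B \<epsilon> \<in> sets lebesgue" for \<epsilon>
  proof -
    have "B \<epsilon> = (\<Inter>t\<in>J. S \<inter> (\<lambda>x. f t x - f t x0) -` cball 0 \<epsilon>)"
      using t0(1) by (auto simp: B_def)
    moreover have "continuous_on S (f t)" if "t \<in> J" for t
      using der[OF that] has_derivative_continuous_on has_derivative_at_withinI by blast
    ultimately have "closedin (top_of_set S) (B \<epsilon>)"
      using t0(1)
      by (auto simp del: INT_simps intro!: closedin_INT continuous_closedin_preimage continuous_intros)
    then obtain T where "closed T" "B \<epsilon> = S \<inter> T"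
      by (auto simp: closedin_closed)
    then show ?thesis using S(1) by auto
  qed
  define n where "n = DIM('a)"
  define V where "V = unit_ball_vol (real n)"
  have V: "V > 0" by (simp add: V_def)
  have "\<forall>\<^sub>F \<epsilon> in at_right 0.
      (1 - \<eta>) ^ n * (measure lebesgue K / V) \<le> measure lebesgue (B \<epsilon>) / measure lebesgue (cball x0 \<epsilon>) \<and>
      measure lebesgue (B \<epsilon>) / measure lebesgue (cball x0 \<epsilon>) \<le> (1 + \<eta>) ^ n * (measure lebesgue K / V)"
    if \<eta>: "0 < \<eta>" "\<eta> < 1" for \<eta>
  proof -
    obtain d where d: "d > 0" "cball x0 d \<subseteq> S"
      "\<And>t x. t \<in> J \<Longrightarrow> x \<in> cball x0 d \<Longrightarrow>
        norm (f t x - f t x0 - D t x0 (x - x0)) \<le> \<eta> * norm (x - x0)"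
      using uniform_linear_approximation[OF J S der cont \<eta>(1)] by blast
    have "\<forall>\<^sub>F \<epsilon> in at_right 0. \<epsilon> \<in> {0<..<d}"
      using eventually_at_right_real d(1) by blast
    then show ?thesis
    proof eventually_elim
      case (elim \<epsilon>)
      then have \<epsilon>: "0 < \<epsilon>" "\<epsilon> < d" by auto
      \<comment> \<open>Shrinking by \<open>1 - \<eta>\<close> leaves exactly the room
        \<open>\<eta> * \<epsilon>\<close> that the linearisation error may use.\<close>
      have lower: "(\<lambda>v. ((1 - \<eta>) * \<epsilon>) *\<^sub>R v + x0) ` K \<subseteq> B \<epsilon>"
      proof clarify
        fix v assume v: "v \<in> K"
        define x where "x = ((1 - \<eta>) * \<epsilon>) *\<^sub>R v + x0"
        have nx: "norm (x - x0) \<le> \<epsilon>"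
          using K1[OF v] \<eta> \<epsilon> by (simp add: x_def abs_mult mult_le_one mult.assoc mult_left_le)
        then have x: "x \<in> cball x0 d" using \<epsilon> by (simp add: dist_norm norm_minus_commute)
        have "norm (f t x - f t x0) \<le> \<epsilon>" if t: "t \<in> J" for t
        proof -
          have "D t x0 (x - x0) = ((1 - \<eta>) * \<epsilon>) *\<^sub>R D t x0 v"
            using linear_scale[OF lin[OF t]] by (simp add: x_def)
          then have "norm (D t x0 (x - x0)) = (1 - \<eta>) * \<epsilon> * norm (D t x0 v)"
            using \<eta> \<epsilon> by (simp add: abs_mult)
          also have "\<dots> \<le> (1 - \<eta>) * \<epsilon>"
            using v t \<eta> \<epsilon> by (intro mult_left_le) (auto simp: K_def)
          finally have "norm (D t x0 (x - x0)) \<le> (1 - \<eta>) * \<epsilon>" .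
          moreover have "norm (f t x - f t x0 - D t x0 (x - x0)) \<le> \<eta> * \<epsilon>"
            using order_trans[OF d(3)[OF t x] mult_left_mono[OF nx]] \<eta> by simp
          ultimately have "norm (f t x - f t x0) \<le> \<eta> * \<epsilon> + (1 - \<eta>) * \<epsilon>"
            using norm_triangle_sub[of "f t x - f t x0" "D t x0 (x - x0)"] by simp
          then show ?thesis by (simp add: algebra_simps)
        qed
        then have "x \<in> B \<epsilon>" using x d(2) by (auto simp: B_def)
        then show "((1 - \<eta>) * \<epsilon>) *\<^sub>R v + x0 \<in> B \<epsilon>" by (simp add: x_def)
      qed
      have upper: "B \<epsilon> \<subseteq> (\<lambda>v. ((1 + \<eta>) * \<epsilon>) *\<^sub>R v + x0) ` K"
      proof
        fix x assume x: "x \<in> B \<epsilon>"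
        \<comment> \<open>The condition at time \<open>t0\<close> alone confines \<open>x\<close> to
          the region where the linearisation bound holds.\<close>
        then have nx: "norm (x - x0) \<le> \<epsilon>"
          using t0 S(2) by (auto simp: B_def)
        then have xd: "x \<in> cball x0 d" using \<epsilon> by (simp add: dist_norm norm_minus_commute)
        \<comment> \<open>The preimage of \<open>x\<close> under the affine map; its norm bounds
          come from adding the linearisation error to \<epsilon>.\<close>
        define v where "v = (1 / ((1 + \<eta>) * \<epsilon>)) *\<^sub>R (x - x0)"
        have pos: "(1 + \<eta>) * \<epsilon> > 0" using \<eta> \<epsilon> by simp
        have "norm (D t x0 v) \<le> 1" if t: "t \<in> J" for t
        proof -
          have "norm (D t x0 (x - x0)) \<le> norm (f t x - f t x0 - D t x0 (x - x0)) + norm (f t x - f t x0)"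
            using norm_triangle_sub[of "D t x0 (x - x0)" "f t x - f t x0"]
            by (simp add: norm_minus_commute)
          also have "\<dots> \<le> \<eta> * \<epsilon> + \<epsilon>"
            using order_trans[OF d(3)[OF t xd] mult_left_mono[OF nx]] \<eta> x t
            by (intro add_mono) (auto simp: B_def)
          also have "\<dots> = (1 + \<eta>) * \<epsilon>" by (simp add: algebra_simps)
          finally have le: "norm (D t x0 (x - x0)) \<le> (1 + \<eta>) * \<epsilon>" .
          have "D t x0 v = (1 / ((1 + \<eta>) * \<epsilon>)) *\<^sub>R D t x0 (x - x0)"
            using linear_scale[OF lin[OF t]] by (simp add: v_def)
          then have "norm (D t x0 v) = norm (D t x0 (x - x0)) / ((1 + \<eta>) * \<epsilon>)"
            using \<eta> \<epsilon> by simp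
          then show ?thesis using le pos by (simp only: divide_le_eq_1) simp
        qed
        then have "v \<in> K" by (simp add: K_def)
        moreover have "x = ((1 + \<eta>) * \<epsilon>) *\<^sub>R v + x0" using \<eta> \<epsilon> by (simp add: v_def)
        ultimately show "x \<in> (\<lambda>v. ((1 + \<eta>) * \<epsilon>) *\<^sub>R v + x0) ` K" by blast
      qed
      have aff: "measure lebesgue ((\<lambda>v. m *\<^sub>R v + x0) ` K) = m ^ n * measure lebesgue K"
        if "m \<ge> 0" for m
        using measure_lebesgue_affine[of m x0 K] that by (simp add: n_def)
      have "(1 - \<eta>) ^ n * \<epsilon> ^ n * measure lebesgue K \<le> measure lebesgue (B \<epsilon>)"
        using measure_mono_fmeasurable[OF lower fmeasurableD[OF affK] fmeasurableI2[OF affK upper Bsets]]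
          aff[of "(1 - \<eta>) * \<epsilon>"] \<eta> \<epsilon> by (simp add: power_mult_distrib)
      moreover have "measure lebesgue (B \<epsilon>) \<le> (1 + \<eta>) ^ n * \<epsilon> ^ n * measure lebesgue K"
        using measure_mono_fmeasurable[OF upper Bsets affK] aff[of "(1 + \<eta>) * \<epsilon>"] \<eta> \<epsilon>
        by (simp add: power_mult_distrib)
      moreover have "measure lebesgue (cball x0 \<epsilon>) = V * \<epsilon> ^ n"
        using content_cball[of \<epsilon> x0] \<epsilon> by (simp add: V_def n_def)
      ultimately show ?case
        using V \<epsilon> by (simp add: field_simps)
    qed
  qed
  then show "((\<lambda>\<epsilon>. measure lebesgue (B \<epsilon>) / measure lebesgue (cball x0 \<epsilon>)) \<longlongrightarrow>
      measure lebesgue K / unit_ball_vol (real DIM('a))) (at_right 0)"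
    unfolding V_def n_def by (rule tendsto_of_power_bounds)
qed

section \<open>Passage to the entropy\<close>

lemma tendsto_elog:
  assumes "(f \<longlongrightarrow> l) F" "l > 0"
  shows "((\<lambda>x. elog (f x)) \<longlongrightarrow> elog l) F"
proof -
  have "((\<lambda>x. ereal (ln (f x))) \<longlongrightarrow> elog l) F"
    using assms by (auto simp: elog_def intro!: tendsto_intros)
  moreover have "\<forall>\<^sub>F x in F. ereal (ln (f x)) = elog (f x)"
    using order_tendstoD(1)[OF assms] by eventually_elim (simp add: elog_def)
  ultimately show ?thesis by (rule Lim_transform_eventually)
qed

theorem corollary10:
  fixes J :: "real set" and X :: "real \<Rightarrow> (real ^ 'n) set"
    and \<phi> :: "real \<Rightarrow> real \<Rightarrow> real ^ 'n \<Rightarrow> real ^ 'n"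
    and \<alpha> t\<^sub>0 :: real and x\<^sub>0 :: "real ^ 'n"
  assumes "Ck_ftnds 2 J X \<phi>"
    and "t\<^sub>0 \<in> J" and "x\<^sub>0 \<in> X t\<^sub>0"
  shows "ftme J X \<phi> \<alpha> t\<^sub>0 x\<^sub>0 =
    - (ereal (1 / time_length J) *
       elog (Gamma (real CARD('n) / 2 + 1) / pi powr (real CARD('n) / 2) *
         measure lebesgue
           (\<Inter>t\<in>J. ellipsoid (exp (- \<alpha> * (t - t\<^sub>0)) *\<^sub>R jacobian (\<phi> t t\<^sub>0) (at x\<^sub>0)))))"
proof -
  define w where "w t = exp (- \<alpha> * (t - t\<^sub>0))" for t
  define S where "S = X t\<^sub>0"
  \<comment> \<open>Since \<open>w\<close> equals 1 at \<open>t\<^sub>0\<close>, the weighted family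
    is still the identity there.\<close>
  define f where "f t x = w t *\<^sub>R \<phi> t t\<^sub>0 x" for t x
  define D where "D t x v = w t *\<^sub>R frechet_derivative (\<phi> t t\<^sub>0) (at x) v" for t x v
  define B where "B \<epsilon> = {x \<in> S. \<forall>t\<in>J. norm (f t x - f t x\<^sub>0) \<le> \<epsilon>}" for \<epsilon>
  define K where "K = {v. \<forall>t\<in>J. norm (D t x\<^sub>0 v) \<le> 1}"
  have J: "compact J" and S: "open S" "x\<^sub>0 \<in> S"
    and id: "\<And>x. x \<in> S \<Longrightarrow> \<phi> t\<^sub>0 t\<^sub>0 x = x"
    and diff: "\<And>t x. t \<in> J \<Longrightarrow> x \<in> S \<Longrightarrow> \<phi> t t\<^sub>0 differentiable (at x)"
    and cont: "\<And>v. continuous_on {(t, s, x). t \<in> J \<and> s \<in> J \<and> x \<in> X s}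
        (\<lambda>(t, s, x). frechet_derivative (\<phi> t s) (at x) v)"
    using assms by (auto simp: Ck_ftnds_def ftnds_def numeral_2_eq_2 S_def)
  have der: "(f t has_derivative D t x) (at x)" if "t \<in> J" "x \<in> S" for t x
    unfolding f_def D_def
    using diff[OF that] by (intro has_derivative_scaleR_right) (simp add: frechet_derivative_works)
  have contD: "continuous_on (J \<times> S) (\<lambda>(t, x). D t x v)" for v
  proof -
    \<comment> \<open>Joint continuity in \<open>(t, s, x)\<close> is restricted to the slice with
      \<open>s\<close> equal to \<open>t\<^sub>0\<close>.\<close>
    have "continuous_on (J \<times> S) (\<lambda>p. (fst p, t\<^sub>0, snd p))"
      by (intro continuous_intros)
    from continuous_on_compose2[OF cont[of v] this]
    have "continuous_on (J \<times> S) (\<lambda>p. frechet_derivative (\<phi> (fst p) t\<^sub>0) (at (snd p)) v)"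
      using assms(2) by (auto simp: S_def image_subset_iff)
    then show ?thesis
      unfolding D_def w_def case_prod_unfold by (intro continuous_intros)
  qed
  have f0: "f t\<^sub>0 x = x" if "x \<in> S" for x
    using id[OF that] by (simp add: f_def w_def)
  note lim = measure_dynamical_ball_tendsto[OF J S der contD assms(2) f0, folded B_def K_def]
  have ball: "ft_ball J X \<phi> \<alpha> t\<^sub>0 x\<^sub>0 = B"
  proof
    fix \<epsilon>
    have "norm (f t x - f t x\<^sub>0) = norm (\<phi> t t\<^sub>0 x - \<phi> t t\<^sub>0 x\<^sub>0) * w t" for t x
      by (simp add: f_def w_def flip: scaleR_diff_right)
    then show "ft_ball J X \<phi> \<alpha> t\<^sub>0 x\<^sub>0 \<epsilon> = B \<epsilon>"
      by (simp add: ft_ball_def B_def SUP_le_iff S_def w_def)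
  qed
  have ell: "(\<Inter>t\<in>J. ellipsoid (exp (- \<alpha> * (t - t\<^sub>0)) *\<^sub>R jacobian (\<phi> t t\<^sub>0) (at x\<^sub>0))) = K"
  proof -
    have "jacobian (\<phi> t t\<^sub>0) (at x\<^sub>0) *v v = frechet_derivative (\<phi> t t\<^sub>0) (at x\<^sub>0) v" if "t \<in> J" for t v
      using diff[OF that S(2)] jacobian_works frechet_derivative_at by metis
    then show ?thesis
      by (auto simp: ellipsoid_eq_vimage K_def D_def w_def simp flip: scaleR_matrix_vector_assoc)
  qed
  \<comment> \<open>The reciprocal of the volume of the Euclidean unit ball.\<close>
  define c where "c = Gamma (real CARD('n) / 2 + 1) / pi powr (real CARD('n) / 2)"
  have c: "c * m = m / unit_ball_vol (real DIM(real ^ 'n))" for m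
    by (simp add: c_def unit_ball_vol_def)
  have "((\<lambda>\<epsilon>. elog (measure lebesgue (B \<epsilon>) / measure lebesgue (cball x\<^sub>0 \<epsilon>))) \<longlongrightarrow>
      elog (c * measure lebesgue K)) (at_right 0)"
    \<comment> \<open>Positive volume of \<open>K\<close> keeps the limit away from 0, where
      \<open>elog\<close> jumps to minus infinity.\<close>
    unfolding c using lim by (intro tendsto_elog divide_pos_pos) auto
  then have "((\<lambda>\<epsilon>. - (ereal (1 / time_length J) *
        elog (measure lebesgue (B \<epsilon>) / measure lebesgue (cball x\<^sub>0 \<epsilon>)))) \<longlongrightarrow>
      - (ereal (1 / time_length J) * elog (c * measure lebesgue K))) (at_right 0)"
    \<comment> \<open>The constant is a finite real also for a one-point \<open>J\<close>: there
      \<open>1 / time_length J\<close> is \<open>1 / 0 = 0\<close>, and both sides of the theorem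
      are 0.\<close>
    by (intro tendsto_uminus_ereal tendsto_cmult_ereal) auto
  then show ?thesis
    unfolding ftme_def ball ell c_def by (intro lim_imp_Limsup) auto
qed

end
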